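(* Let $n,r\in\mathbb N$, let $X=\{x_1,\dots,x_n\}$ be an alphabet of cardinality $n$, and let $\lambda$ be a partition written as $$\lambda=[n+\nu_1,\dots,n+\nu_k,\zeta_1,\zeta_2,\dots]=[n^k+\nu,\zeta],$$ with $\nu=(\nu_1,\dots,\nu_k)$ a partition and $\zeta$ a partition with $\zeta_1<n$. Then $$Q'_\lambda(t^r-X)=t^{\mathbf n(\nu)+r|\nu|}\prod_{i=r}^{k+r-1}\prod_{j=1}^n(t^i-x_j)\;Q'_\zeta(t^{k+r}-X).$$
   Context: Coefficients lie in $\mathbb Q[[t]]$. Arguments of symmetric functions are in the $\lambda$-ring sense: $p_m(t^s-X)=t^{sm}-p_m(X)$ for power sums $p_m$ (so $t^s$ behaves as a single letter). $Q'_\lambda(X)=Q_\lambda(X/(1-t))$ is the modified Hall–Littlewood function, $Q_\lambda$ being Macdonald's Hall–Littlewood $Q$-function. For a partition $\nu$, $\mathbf n(\nu)=\sum_i(i-1)\nu_i$ and $|\nu|=\sum_i\nu_i$. *)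

theory Defs
  imports
    "HOL-Library.Poly_Mapping"
    "HOL-Computational_Algebra.Computational_Algebra"
    "HOL-Combinatorics.Permutations"
begin

text \<open>
  Polynomials over \<open>\<rat>[[t]]\<close> in countably many indeterminates. The type is used in two ways:
  for the polynomial ring \<open>\<rat>[[t]][x\<^sub>1, x\<^sub>2, \<dots>]\<close>, where \<open>indet j\<close> is the letter \<open>x\<^sub>j\<close>;
  and for the ring of symmetric functions \<open>\<Lambda> = \<rat>[[t]][p\<^sub>1, p\<^sub>2, \<dots>]\<close>, where \<open>indet i\<close> is the
  power sum \<open>p\<^sub>i\<^sub>+\<^sub>1\<close> (so that there is no \<open>p\<^sub>0\<close>).
\<close>

type_synonym xpoly = "(nat \<Rightarrow>\<^sub>0 nat) \<Rightarrow>\<^sub>0 rat fps"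

type_synonym symfun = "(nat \<Rightarrow>\<^sub>0 nat) \<Rightarrow>\<^sub>0 rat fps"

definition scalar :: "rat fps \<Rightarrow> ((nat \<Rightarrow>\<^sub>0 nat) \<Rightarrow>\<^sub>0 rat fps)" where
  "scalar c = Poly_Mapping.single 0 c"

definition indet :: "nat \<Rightarrow> ((nat \<Rightarrow>\<^sub>0 nat) \<Rightarrow>\<^sub>0 rat fps)" where
  "indet i = Poly_Mapping.single (Poly_Mapping.single i 1) 1"

abbreviation tt :: "(nat \<Rightarrow>\<^sub>0 nat) \<Rightarrow>\<^sub>0 rat fps" where
  "tt \<equiv> scalar fps_X"

text \<open>
  A \<open>\<lambda>\<close>-ring argument \<open>A\<close> is given by its power sums \<open>m \<mapsto> p\<^sub>m(A)\<close> for \<open>m \<ge> 1\<close>; then \<open>pleth f A\<close> is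
  \<open>f(A)\<close>, the image of \<open>f\<close> under the \<open>\<rat>[[t]]\<close>-algebra homomorphism \<open>p\<^sub>m \<mapsto> p\<^sub>m(A)\<close>.
\<close>

definition pleth :: "symfun \<Rightarrow> (nat \<Rightarrow> (nat \<Rightarrow>\<^sub>0 nat) \<Rightarrow>\<^sub>0 rat fps) \<Rightarrow> ((nat \<Rightarrow>\<^sub>0 nat) \<Rightarrow>\<^sub>0 rat fps)" where
  "pleth f A =
     (\<Sum>e\<in>Poly_Mapping.keys f. scalar (Poly_Mapping.lookup f e) *
        (\<Prod>i\<in>Poly_Mapping.keys e. A (Suc i) ^ Poly_Mapping.lookup e i))"

definition alphabet :: "nat \<Rightarrow> nat \<Rightarrow> xpoly" where
  "alphabet n m = (\<Sum>j=1..n. indet j ^ m)"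

definition t_minus_alphabet :: "nat \<Rightarrow> nat \<Rightarrow> nat \<Rightarrow> xpoly" where
  "t_minus_alphabet s n m = tt ^ (s * m) - alphabet n m"

text \<open>The argument \<open>X/(1 - t)\<close> for generic \<open>X\<close>: \<open>p\<^sub>m(X/(1 - t)) = p\<^sub>m / (1 - t\<^sup>m)\<close>, with \<open>m \<ge> 1\<close>.\<close>

definition over_one_minus_t :: "nat \<Rightarrow> symfun" where
  "over_one_minus_t m = scalar (inverse (1 - fps_X ^ m)) * indet (m - 1)"

text \<open>
  Partitions are weakly decreasing lists. Trailing zeros are allowed and irrelevant;
  \<open>part \<mu> i\<close> is the \<open>i\<close>-th part for \<open>i \<ge> 1\<close>, and is zero beyond the end of the list.
\<close>

definition is_partition :: "nat list \<Rightarrow> bool" where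
  "is_partition \<mu> \<longleftrightarrow> sorted_wrt (\<ge>) \<mu>"

definition part :: "nat list \<Rightarrow> nat \<Rightarrow> nat" where
  "part \<mu> i = (if 1 \<le> i \<and> i \<le> length \<mu> then \<mu> ! (i - 1) else 0)"

definition weight :: "nat list \<Rightarrow> nat" where
  "weight \<mu> = (\<Sum>i=1..length \<mu>. part \<mu> i)"

definition n_stat :: "nat list \<Rightarrow> nat" where
  "n_stat \<mu> = (\<Sum>i=1..length \<mu>. (i - 1) * part \<mu> i)"

text \<open>
  Macdonald's Hall--Littlewood polynomials in \<open>N\<close> variables
  (Symmetric Functions and Hall Polynomials, Chapter III), for \<open>N \<ge> length \<mu>\<close>:
  \<open>R\<^sub>\<mu> = \<Sum>\<^sub>w w(x\<^sup>\<mu> \<Prod>\<^sub>i\<^sub><\<^sub>j (x\<^sub>i - t x\<^sub>j)/(x\<^sub>i - x\<^sub>j))\<close>, \<open>P\<^sub>\<mu> = R\<^sub>\<mu> / v\<^sub>\<mu>\<close> and \<open>Q\<^sub>\<mu> = b\<^sub>\<mu> P\<^sub>\<mu>\<close>.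
  The multiplicity of the part \<open>0\<close>, which enters \<open>v\<^sub>\<mu>\<close> but not \<open>b\<^sub>\<mu>\<close>, depends on \<open>N\<close>.
\<close>

definition part_mult :: "nat \<Rightarrow> nat list \<Rightarrow> nat \<Rightarrow> nat" where
  "part_mult N \<mu> a = card {i \<in> {1..N}. part \<mu> i = a}"

definition hl_R :: "'a::field \<Rightarrow> (nat \<Rightarrow> 'a) \<Rightarrow> nat \<Rightarrow> nat list \<Rightarrow> 'a" where
  "hl_R t x N \<mu> =
     (\<Sum>w | w permutes {1..N}.
        (\<Prod>i=1..N. x (w i) ^ part \<mu> i) *
        (\<Prod>i=1..N. \<Prod>j\<in>{i<..N}. (x (w i) - t * x (w j)) / (x (w i) - x (w j))))"

definition hl_v :: "'a::field \<Rightarrow> nat \<Rightarrow> nat list \<Rightarrow> 'a" where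
  "hl_v t N \<mu> =
     (\<Prod>a\<in>part \<mu> ` {1..N}. \<Prod>i=1..part_mult N \<mu> a. (1 - t ^ i) / (1 - t))"

definition hl_b :: "'a::field \<Rightarrow> nat \<Rightarrow> nat list \<Rightarrow> 'a" where
  "hl_b t N \<mu> =
     (\<Prod>a\<in>part \<mu> ` {1..N} - {0}. \<Prod>i=1..part_mult N \<mu> a. (1 - t ^ i))"

definition hl_P :: "'a::field \<Rightarrow> (nat \<Rightarrow> 'a) \<Rightarrow> nat \<Rightarrow> nat list \<Rightarrow> 'a" where
  "hl_P t x N \<mu> = hl_R t x N \<mu> / hl_v t N \<mu>"

definition hl_Q :: "'a::field \<Rightarrow> (nat \<Rightarrow> 'a) \<Rightarrow> nat \<Rightarrow> nat list \<Rightarrow> 'a" where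
  "hl_Q t x N \<mu> = hl_b t N \<mu> * hl_P t x N \<mu>"

text \<open>
  The symmetric function \<open>Q\<^sub>\<mu>\<close> is the element of \<open>\<Lambda>\<close> that restricts to \<open>Q\<^sub>\<mu>(x\<^sub>1, \<dots>, x\<^sub>N; t)\<close>
  for every \<open>N \<ge> length \<mu>\<close>; the comparison takes place in the fraction field of
  \<open>\<rat>[[t]][x\<^sub>1, x\<^sub>2, \<dots>]\<close>.
\<close>

definition HL_Q :: "nat list \<Rightarrow> symfun" where
  "HL_Q \<mu> = (THE f. \<forall>N \<ge> length \<mu>.
     to_fract (pleth f (alphabet N)) = hl_Q (to_fract tt) (\<lambda>j. to_fract (indet j)) N \<mu>)"

definition HL_Q' :: "nat list \<Rightarrow> symfun" where
  "HL_Q' \<mu> = pleth (HL_Q \<mu>) over_one_minus_t"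

end

theory Submission
  imports Defs "HOL-Combinatorics.Multiset_Permutations"
begin

text \<open>
  Removing one letter \<open>x\<^sub>i\<close> at a time from Macdonald's symmetrisation formula gives
  \<open>Q\<^sub>(\<^sub>m\<^sub>,\<^sub>\<mu>\<^sub>)(X) = \<Sum>\<^sub>i g\<^sub>i x\<^sub>i\<^sup>m Q\<^sub>\<mu>(X - x\<^sub>i)\<close> for \<open>m \<ge> 1\<close>, and \<open>\<Sum>\<^sub>i g\<^sub>i x\<^sub>i\<^sup>m = q\<^sub>m\<close> by partial fractions.
  Writing \<open>f(X - z) = \<Sum>\<^sub>j z\<^sup>j D\<^sub>j f(X)\<close> this becomes \<open>Q\<^sub>(\<^sub>m\<^sub>,\<^sub>\<mu>\<^sub>) = \<Sum>\<^sub>j q\<^sub>m\<^sub>+\<^sub>j D\<^sub>j Q\<^sub>\<mu>\<close>, which constructs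
  \<open>Q\<^sub>\<mu>\<close> in \<open>\<Lambda>\<close>; algebraic independence of the power sums makes it unique.
  At \<open>(t\<^sup>r - X)/(1 - t)\<close> the function \<open>q\<^sub>M\<close> takes the value \<open>h\<^sub>M(t\<^sup>r - X)\<close>, which for \<open>M \<ge> n\<close> is the
  geometric sequence \<open>t\<^sup>r\<^sup>(\<^sup>M\<^sup>-\<^sup>n\<^sup>) \<Prod>\<^sub>j (t\<^sup>r - x\<^sub>j)\<close>. For \<open>m = n + a\<close> the sum over \<open>j\<close> therefore collapses to
  \<open>Q\<^sub>\<mu>\<close> evaluated at \<open>(t\<^sup>r - X)/(1 - t) - t\<^sup>r = (t\<^sup>r\<^sup>+\<^sup>1 - X)/(1 - t)\<close>, and each part \<open>n + \<nu>\<^sub>i\<close> peels off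
  one factor of the product.
\<close>

unbundle fps_syntax

section \<open>Evaluation of symmetric functions\<close>

locale ring_morphism =
  fixes h :: "'a::comm_ring_1 \<Rightarrow> 'b::comm_ring_1"
  assumes add: "h (x + y) = h x + h y"
    and mult: "h (x * y) = h x * h y"
    and one: "h 1 = 1"
begin

lemma zero: "h 0 = 0"
  using add[of 0 0] by simp

lemma minus: "h (x - y) = h x - h y"
  using add[of "x - y" y] by simp

lemma power: "h (x ^ m) = h x ^ m"
  by (induction m) (simp_all add: one mult)

lemma sum: "h (\<Sum>i\<in>I. f i) = (\<Sum>i\<in>I. h (f i))"
  by (induction I rule: infinite_finite_induct) (simp_all add: zero add)

lemma prod: "h (\<Prod>i\<in>I. f i) = (\<Prod>i\<in>I. h (f i))"
  by (induction I rule: infinite_finite_induct) (simp_all add: one mult)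

lemma of_nat: "h (of_nat m) = of_nat m"
  by (induction m) (simp_all add: zero one add)

lemmas simps = zero one add mult minus power sum prod of_nat

end

lemma ring_morphism_scalar: "ring_morphism scalar"
  by unfold_locales (simp_all add: scalar_def single_add mult_single)

lemma ring_morphism_to_fract: "ring_morphism to_fract"
  by unfold_locales simp_all

lemma ring_morphism_comp:
  "ring_morphism g \<Longrightarrow> ring_morphism h \<Longrightarrow> ring_morphism (\<lambda>x. g (h x))"
  by (simp add: ring_morphism_def)

lemma ring_morphism_poly: "ring_morphism (\<lambda>p. poly p x)"
  by unfold_locales simp_all

lemma ring_morphism_poly_map:
  assumes "ring_morphism h"
  shows "ring_morphism (\<lambda>p. poly (map_poly h p) z)"
proof -
  interpret ring_morphism h by fact
  have add': "map_poly h (p + q) = map_poly h p + map_poly h q" for p q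
    by (rule poly_eqI) (simp add: coeff_map_poly zero add)
  have mult': "map_poly h (p * q) = map_poly h p * map_poly h q" for p q
    by (rule poly_eqI) (simp add: coeff_map_poly zero coeff_mult sum mult)
  show ?thesis
    by unfold_locales (simp_all add: add' mult' one)
qed

definition monomial_eval :: "(nat \<Rightarrow> 'b::comm_ring_1) \<Rightarrow> (nat \<Rightarrow>\<^sub>0 nat) \<Rightarrow> 'b" where
  "monomial_eval A e = (\<Prod>i\<in>Poly_Mapping.keys e. A (Suc i) ^ Poly_Mapping.lookup e i)"

text \<open>More general than \<open>pleth\<close>: the coefficients pass through \<phi>, so that
  the target can also be the fraction field, a ring of univariate polynomials, or
  \<open>rat fps\<close> itself.\<close>

definition symeval :: "(rat fps \<Rightarrow> 'b::comm_ring_1) \<Rightarrow> (nat \<Rightarrow> 'b) \<Rightarrow> symfun \<Rightarrow> 'b" where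
  "symeval \<phi> A f =
     (\<Sum>e\<in>Poly_Mapping.keys f. \<phi> (Poly_Mapping.lookup f e) * monomial_eval A e)"

lemma pleth_eq_symeval: "pleth f A = symeval scalar A f"
  by (simp add: pleth_def symeval_def monomial_eval_def)

lemma monomial_eval_superset:
  assumes "finite I" "Poly_Mapping.keys e \<subseteq> I"
  shows "monomial_eval A e = (\<Prod>i\<in>I. A (Suc i) ^ Poly_Mapping.lookup e i)"
  unfolding monomial_eval_def using assms
  by (intro prod.mono_neutral_left) (auto simp: in_keys_iff)

lemma monomial_eval_add: "monomial_eval A (d + e) = monomial_eval A d * monomial_eval A e"
proof -
  let ?I = "Poly_Mapping.keys d \<union> Poly_Mapping.keys e"
  have "Poly_Mapping.keys (d + e) \<subseteq> ?I"
    by (rule keys_add)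
  then show ?thesis
    by (simp add: monomial_eval_superset[of ?I] lookup_add power_add prod.distrib)
qed

lemma poly_mapping_sum_singles:
  fixes f :: symfun
  shows "f = (\<Sum>e\<in>Poly_Mapping.keys f. Poly_Mapping.single e (Poly_Mapping.lookup f e))"
  by (rule poly_mapping_eqI)
    (auto simp: lookup_sum lookup_single when_def in_keys_iff)

lemma symeval_cong:
  assumes "\<And>c. \<phi> c = \<psi> c" "\<And>i. A (Suc i) = B (Suc i)"
  shows "symeval \<phi> A f = symeval \<psi> B f"
  by (simp add: symeval_def monomial_eval_def assms)

context
  fixes \<phi> :: "rat fps \<Rightarrow> 'b::comm_ring_1"
  assumes \<phi>: "ring_morphism \<phi>"
begin

interpretation \<phi>: ring_morphism \<phi> by (fact \<phi>)

lemma symeval_single: "symeval \<phi> A (Poly_Mapping.single e c) = \<phi> c * monomial_eval A e"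
  by (cases "c = 0") (simp_all add: symeval_def \<phi>.zero)

lemma symeval_scalar: "symeval \<phi> A (scalar c) = \<phi> c"
  by (simp add: scalar_def symeval_single monomial_eval_def)

lemma symeval_indet: "symeval \<phi> A (indet i) = A (Suc i)"
  by (simp add: indet_def symeval_single monomial_eval_def \<phi>.one)

lemma symeval_add: "symeval \<phi> A (f + g) = symeval \<phi> A f + symeval \<phi> A g"
  unfolding symeval_def
  by (rule setsum_keys_plus_distrib) (simp_all add: \<phi>.zero \<phi>.add algebra_simps)

lemma symeval_sum: "symeval \<phi> A (\<Sum>i\<in>I. f i) = (\<Sum>i\<in>I. symeval \<phi> A (f i))"
  by (induction I rule: infinite_finite_induct) (simp_all add: symeval_add symeval_def[of _ _ 0])

lemma symeval_mult: "symeval \<phi> A (f * g) = symeval \<phi> A f * symeval \<phi> A g"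
proof -
  let ?s = "\<lambda>f e. Poly_Mapping.single e (Poly_Mapping.lookup f e) :: symfun"
  have "f * g = (\<Sum>d\<in>Poly_Mapping.keys f. \<Sum>e\<in>Poly_Mapping.keys g. ?s f d * ?s g e)"
    unfolding sum_product[symmetric] poly_mapping_sum_singles[symmetric] ..
  also have "symeval \<phi> A \<dots> = (\<Sum>d\<in>Poly_Mapping.keys f. \<Sum>e\<in>Poly_Mapping.keys g.
      symeval \<phi> A (?s f d) * symeval \<phi> A (?s g e))"
    by (simp add: symeval_sum mult_single symeval_single monomial_eval_add \<phi>.mult mult_ac)
  also have "\<dots> = symeval \<phi> A f * symeval \<phi> A g"
    by (simp only: symeval_single symeval_def[of \<phi> A f] symeval_def[of \<phi> A g] sum_product)
  finally show ?thesis .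
qed

lemma ring_morphism_symeval: "ring_morphism (symeval \<phi> A)"
proof
  show "symeval \<phi> A 1 = 1"
    using symeval_scalar[of A 1] by (simp add: scalar_def \<phi>.one)
qed (simp_all add: symeval_add symeval_mult)

end

lemma ring_morphism_symeval_apply:
  assumes "ring_morphism h"
  shows "h (symeval \<phi> A f) = symeval (\<lambda>c. h (\<phi> c)) (\<lambda>m. h (A m)) f"
proof -
  interpret ring_morphism h by fact
  show ?thesis by (simp add: symeval_def monomial_eval_def simps)
qed

text \<open>The polynomial \<open>f(X - z)\<close> in the extra variable \<open>z\<close>.\<close>

definition sym_shift :: "symfun \<Rightarrow> symfun poly" where
  "sym_shift f = symeval (\<lambda>c. [:scalar c:]) (\<lambda>m. [:indet (m - 1):] - monom 1 m) f"

text \<open>Mapping the coefficients of \<open>sym_shift f\<close> by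
  \<open>symeval \<phi> A\<close> and inserting \<open>z\<close> is a morphism in \<open>f\<close>,
  and it sends the \<open>m\<close>-th power sum to \<open>A m - z ^ m\<close>.\<close>

lemma symeval_shift:
  assumes "ring_morphism \<phi>"
  shows "symeval \<phi> (\<lambda>m. A m - z ^ m) f =
    (\<Sum>j\<le>degree (sym_shift f). symeval \<phi> A (coeff (sym_shift f) j) * z ^ j)"
proof -
  interpret E: ring_morphism "symeval \<phi> A"
    by (rule ring_morphism_symeval) fact
  let ?E = "\<lambda>p. poly (map_poly (symeval \<phi> A) p) z"
  interpret Ez: ring_morphism ?E
    by (rule ring_morphism_poly_map) unfold_locales
  have "?E (sym_shift f) = symeval \<phi> (\<lambda>m. A m - z ^ m) f"
    unfolding sym_shift_def ring_morphism_symeval_apply[OF Ez.ring_morphism_axioms]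
    by (rule symeval_cong)
      (simp_all add: Ez.minus map_poly_pCons E.zero E.one map_poly_monom poly_monom
        symeval_scalar[OF assms] symeval_indet[OF assms])
  moreover have "?E p = (\<Sum>j\<le>degree p. symeval \<phi> A (coeff p j) * z ^ j)" for p
  proof -
    have "degree (map_poly (symeval \<phi> A) p) \<le> degree p"
      by (rule map_poly_degree_leq)
    then show ?thesis
      unfolding poly_altdef
      by (subst sum.mono_neutral_left[of "{..degree p}" "{..degree (map_poly (symeval \<phi> A) p)}"])
        (auto simp: coeff_map_poly E.zero coeff_eq_0 not_le
          dest: order.strict_trans2[of "degree (map_poly (symeval \<phi> A) p)"]
          intro!: mult_eq_0_iff[THEN iffD2])
  qed
  ultimately show ?thesis by simp
qed

text \<open>
  Newton's recursion for \<open>\<Sum>\<^sub>m q\<^sub>m u\<^sup>m = exp (\<Sum>\<^sub>r (1 - t\<^sup>r) p\<^sub>r u\<^sup>r / r)\<close>, obtained from the logarithmic derivative.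
\<close>

fun q_fun :: "nat \<Rightarrow> symfun" where
  "q_fun 0 = 1"
| "q_fun (Suc m) = scalar (fps_const (1 / of_nat (Suc m))) *
     (\<Sum>i=0..m. scalar (1 - fps_X ^ Suc i) * indet i * q_fun (m - i))"

text \<open>The coefficient of \<open>u^k\<close> in \<open>G' = P * G\<close> is the recursion of
  \<open>q_fun\<close>, so evaluating \<open>q_fun\<close> amounts to finding a series with the
  right logarithmic derivative.\<close>

lemma symeval_q_fun:
  fixes \<phi> :: "rat fps \<Rightarrow> 'b::idom" and G P :: "'b fps"
  assumes \<phi>: "ring_morphism \<phi>"
    and G0: "G $ 0 = 1" and G': "fps_deriv G = P * G"
    and P: "\<And>i. P $ i = (1 - \<phi> fps_X ^ Suc i) * A (Suc i)"
  shows "symeval \<phi> A (q_fun m) = G $ m"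
proof (induction m rule: less_induct)
  case (less m)
  interpret \<phi>: ring_morphism \<phi> by fact
  interpret E: ring_morphism "symeval \<phi> A"
    by (rule ring_morphism_symeval) fact
  show ?case
  proof (cases m)
    case 0
    then show ?thesis by (simp add: E.one G0)
  next
    case (Suc k)
    \<comment> \<open>The image of \<open>1 / (k + 1)\<close> is an inverse of \<open>k + 1\<close>,
      so this factor can be cancelled in the target, whose characteristic is not given.\<close>
    have "of_nat (Suc k) * \<phi> (fps_const (1 / of_nat (Suc k))) =
        \<phi> (of_nat (Suc k) * fps_const (1 / of_nat (Suc k)))"
      by (simp only: \<phi>.mult \<phi>.of_nat)
    also have "of_nat (Suc k) * fps_const (1 / of_nat (Suc k)) = (1 :: rat fps)"
      by (simp only: fps_of_nat[symmetric] fps_const_mult) simp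
    finally have inv: "of_nat (Suc k) * \<phi> (fps_const (1 / of_nat (Suc k))) = 1"
      by (simp only: \<phi>.one)
    then have "of_nat (Suc k) \<noteq> (0 :: 'b)"
      by auto
    moreover have "of_nat (Suc k) * symeval \<phi> A (q_fun (Suc k)) =
        (of_nat (Suc k) * \<phi> (fps_const (1 / of_nat (Suc k)))) * (\<Sum>i=0..k. P $ i * G $ (k - i))"
      using less by (simp del: power_Suc add: E.simps symeval_scalar[OF \<phi>] symeval_indet[OF \<phi>]
          \<phi>.minus \<phi>.one \<phi>.power P Suc mult_ac)
    moreover have "(\<Sum>i=0..k. P $ i * G $ (k - i)) = of_nat (Suc k) * G $ Suc k"
      using arg_cong[OF G', of "\<lambda>F. F $ k"] by (simp add: fps_mult_nth)
    ultimately show ?thesis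
      using Suc inv by (metis mult_1 mult_left_cancel)
  qed
qed

section \<open>Algebraic independence of the power sums\<close>

lemma infinite_range_of_nat_fps: "infinite (range (of_nat :: nat \<Rightarrow> rat fps))"
  by (rule range_inj_infinite) (auto simp: inj_on_def simp flip: fps_of_nat)

text \<open>Along a polynomial curve \<open>f\<close> becomes a univariate polynomial over a domain,
  which is zero as soon as it has infinitely many roots.\<close>

lemma symeval_curve:
  fixes A :: "nat \<Rightarrow> rat fps poly"
  assumes "infinite S" and S: "\<And>x. x \<in> S \<Longrightarrow> symeval (\<lambda>c. c) (\<lambda>m. poly (A m) x) f = 0"
  shows "symeval (\<lambda>c. c) (\<lambda>m. poly (A m) x) f = 0"
proof -
  define p where "p = symeval (\<lambda>c. [:c:]) A f"
  have p: "poly p x = symeval (\<lambda>c. c) (\<lambda>m. poly (A m) x) f" for x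
    unfolding p_def ring_morphism_symeval_apply[OF ring_morphism_poly] by simp
  have "S \<subseteq> {x. poly p x = 0}"
    using S p by auto
  then have "p = 0"
    using poly_roots_finite[of p] \<open>infinite S\<close> finite_subset by blast
  then show ?thesis
    using p[of x] by simp
qed

lemma monomial_eval_upd:
  "monomial_eval (A(Suc i := x)) e = monomial_eval (A(Suc i := 1)) e * x ^ Poly_Mapping.lookup e i"
proof -
  let ?I = "insert i (Poly_Mapping.keys e)"
  have *: "monomial_eval (A(Suc i := x)) e =
      x ^ Poly_Mapping.lookup e i * (\<Prod>j\<in>?I - {i}. A (Suc j) ^ Poly_Mapping.lookup e j)" for x
    by (subst monomial_eval_superset[of ?I]) (auto simp: prod.remove[of ?I i])
  show ?thesis
    by (simp add: *[of x] *[of 1])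
qed

text \<open>Prescribing the exponents of one variable after another splits \<open>f\<close> into
  slices that still vanish at every point. Once all occurring variables are treated, a slice is a
  single monomial.\<close>

lemma symeval_vanishing_imp_zero:
  assumes vanish: "\<And>v. symeval (\<lambda>c. c) v f = 0"
  shows "f = 0"
proof (rule ccontr)
  assume "f \<noteq> 0"
  let ?K = "\<lambda>I k. {e \<in> Poly_Mapping.keys f. \<forall>i\<in>I. Poly_Mapping.lookup e i = k i}"
  have slice: "(\<Sum>e\<in>?K I k. Poly_Mapping.lookup f e * monomial_eval v e) = 0"
    if "finite I" for I and k :: "nat \<Rightarrow> nat" and v
    using that
  proof (induction I arbitrary: v rule: finite_induct)
    case empty
    then show ?case
      using vanish[of v] by (simp add: symeval_def)
  next
    case (insert i I)
    define c where "c e = Poly_Mapping.lookup f e * monomial_eval (v(Suc i := 1)) e" for e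
    \<comment> \<open>The slice as a polynomial in coordinate \<open>Suc i\<close> of the point; its
      coefficient at \<open>k i\<close> is the finer slice without the power of that
      coordinate.\<close>
    define p where "p = (\<Sum>e\<in>?K I k. monom (c e) (Poly_Mapping.lookup e i))"
    have "poly p x = 0" for x
      using insert.IH[of "v(Suc i := x)"] unfolding monomial_eval_upd[of v i x]
      by (simp add: p_def poly_sum poly_monom c_def mult.assoc)
    then have "p = 0"
      using poly_roots_finite[of p] infinite_range_of_nat_fps
      by (metis (mono_tags, lifting) UNIV_I finite_subset mem_Collect_eq subsetI)
    have "(\<Sum>e\<in>?K (insert i I) k. c e) = coeff p (k i)"
      unfolding p_def coeff_sum coeff_monom
      by (intro sum.mono_neutral_cong_left) auto
    then have "(\<Sum>e\<in>?K (insert i I) k. c e) * v (Suc i) ^ k i = 0"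
      by (simp add: \<open>p = 0\<close>)
    moreover have "Poly_Mapping.lookup f e * monomial_eval v e = c e * v (Suc i) ^ k i"
      if "e \<in> ?K (insert i I) k" for e
      using that monomial_eval_upd[of v i "v (Suc i)" e] by (simp add: c_def)
    ultimately show ?case
      by (simp add: sum_distrib_right)
  qed
  from \<open>f \<noteq> 0\<close> obtain e where e: "e \<in> Poly_Mapping.keys f"
    by (metis keys_eq_empty all_not_in_conv)
  define I where "I = (\<Union>d\<in>Poly_Mapping.keys f. Poly_Mapping.keys d)"
  have "d = e" if "d \<in> ?K I (Poly_Mapping.lookup e)" for d
  proof (rule poly_mapping_eqI)
    fix i
    show "Poly_Mapping.lookup d i = Poly_Mapping.lookup e i"
    proof (cases "i \<in> I")
      case False
      then have "i \<notin> Poly_Mapping.keys d" "i \<notin> Poly_Mapping.keys e"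
        using that e by (auto simp: I_def)
      then show ?thesis by (simp add: in_keys_iff)
    qed (use that in auto)
  qed
  then have "?K I (Poly_Mapping.lookup e) = {e}"
    using e by auto
  with slice[where I = I and k = "Poly_Mapping.lookup e" and v = "\<lambda>_. 1"] have "Poly_Mapping.lookup f e = 0"
    by (simp add: I_def monomial_eval_def)
  with e show False
    by (simp add: in_keys_iff)
qed

text \<open>
  The vanishing of \<open>f\<close> spreads from power sums of actual alphabets to arbitrary values of
  \<open>p\<^sub>1, \<dots>, p\<^sub>M\<close>, one coordinate at a time from the top: a letter \<open>1/s\<close> may be added with any
  multiplicity, since \<open>f\<close> is polynomial in the multiplicity; with multiplicity \<open>c s\<^sup>m\<close> it changes \<open>p\<^sub>i\<close>
  by \<open>c s\<^sup>m\<^sup>-\<^sup>i\<close>, so that \<open>s = 0\<close> changes \<open>p\<^sub>m\<close> alone among \<open>p\<^sub>1, \<dots>, p\<^sub>m\<close>.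
\<close>

theorem power_sums_algebraically_independent:
  assumes vanish: "\<And>N. N \<ge> L \<Longrightarrow> pleth f (alphabet N) = 0"
  shows "f = 0"
proof -
  define Z where "Z u \<longleftrightarrow> symeval (\<lambda>c. c) u f = 0" for u
  define P where "P v \<longleftrightarrow> (\<exists>N\<ge>L. \<exists>y. v = (\<lambda>m. \<Sum>j=1..N. y j ^ m))" for v :: "nat \<Rightarrow> rat fps"
  have id: "ring_morphism (\<lambda>c :: rat fps. c)"
    by unfold_locales auto
  have PZ: "Z v" if "P v" for v
  proof -
    from that obtain N y where N: "N \<ge> L" and v: "v = (\<lambda>m. \<Sum>j=1..N. y j ^ m)"
      by (auto simp: P_def)
    \<comment> \<open>\<open>symeval\<close> reads its argument for \<open>indet j\<close> at index
      \<open>j + 1\<close>, hence the shift.\<close>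
    define y' where "y' m = y (m - 1)" for m
    interpret E: ring_morphism "symeval (\<lambda>c. c) y'"
      by (rule ring_morphism_symeval[OF id])
    have "symeval (\<lambda>c. c) y' (pleth f (alphabet N)) = symeval (\<lambda>c. c) v f"
      unfolding pleth_eq_symeval ring_morphism_symeval_apply[OF E.ring_morphism_axioms]
      by (rule symeval_cong)
        (simp_all add: symeval_scalar[OF id] alphabet_def E.sum E.mult E.power
          symeval_indet[OF id] v y'_def)
    then show ?thesis
      using vanish[OF N] by (simp add: Z_def E.zero)
  qed
  have P_add: "P (\<lambda>m. v m + y ^ m)" if "P v" for v y
  proof -
    from that obtain N z where N: "N \<ge> L" and v: "v = (\<lambda>m. \<Sum>j=1..N. z j ^ m)"
      by (auto simp: P_def)
    have "(\<lambda>m. v m + y ^ m) = (\<lambda>m. \<Sum>j=1..Suc N. (z(Suc N := y)) j ^ m)"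
      by (simp add: v)
    then show ?thesis
      unfolding P_def using N le_SucI by blast
  qed
  have P_add_mult: "P (\<lambda>m. v m + of_nat c * y ^ m)" if "P v" for v y c
  proof (induction c)
    case (Suc c)
    from P_add[OF Suc, of y] show ?case
      by (simp add: algebra_simps)
  qed (use that in simp)
  define I where "I = (\<Union>d\<in>Poly_Mapping.keys f. Poly_Mapping.keys d)"
  \<comment> \<open>Only the first \<open>M\<close> power sums occur in \<open>f\<close>; inserting
    0 keeps \<open>Max\<close> meaningful when \<open>f\<close> is constant.\<close>
  define M where "M = Suc (Max (insert 0 I))"
  have Z_cong: "Z u \<longleftrightarrow> Z w" if "\<And>i. 1 \<le> i \<Longrightarrow> i \<le> M \<Longrightarrow> u i = w i" for u w
  proof -
    have "u (Suc i) = w (Suc i)" if "d \<in> Poly_Mapping.keys f" "i \<in> Poly_Mapping.keys d" for i d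
    proof -
      have "i \<in> I" "finite I"
        using that by (auto simp: I_def)
      then have "i \<le> Max (insert 0 I)"
        by simp
      then show ?thesis
        using \<open>\<And>i. 1 \<le> i \<Longrightarrow> i \<le> M \<Longrightarrow> u i = w i\<close>[of "Suc i"] by (simp add: M_def)
    qed
    then show ?thesis
      by (simp add: Z_def symeval_def monomial_eval_def)
  qed
  have Z_curve: "Z (\<lambda>m. poly (A m) x)"
    if "infinite S" "\<And>x. x \<in> S \<Longrightarrow> Z (\<lambda>m. poly (A m) x)" for S A x
    using symeval_curve[of S A f x] that unfolding Z_def by blast
  \<comment> \<open>Downward induction on \<open>m\<close>: the coordinates above \<open>m\<close>
    are already free, those up to \<open>m\<close> still come from an alphabet.\<close>
  have Z_above: "\<forall>v w. P v \<longrightarrow> (\<forall>i. 1 \<le> i \<longrightarrow> i \<le> m \<longrightarrow> w i = v i) \<longrightarrow> Z w" if "m \<le> M" for m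
    using that
  proof (induction rule: inc_induct)
    case base
    show ?case
    proof (intro allI impI)
      fix v w
      assume "P v" "\<forall>i. 1 \<le> i \<longrightarrow> i \<le> M \<longrightarrow> w i = v i"
      then show "Z w"
        using PZ[of v] Z_cong[of w v] by simp
    qed
  next
    case (step m)
    show ?case
    proof (intro allI impI)
      fix v w
      assume v: "P v" and w: "\<forall>i. 1 \<le> i \<longrightarrow> i \<le> m \<longrightarrow> w i = v i"
      define c' where "c' = w (Suc m) - v (Suc m)"
      \<comment> \<open>For natural \<open>c\<close> this is an alphabet with \<open>y\<close>
        adjoined \<open>c\<close> times; these are infinitely many points on a line in
        \<open>c\<close>.\<close>
      have letters: "Z (\<lambda>i. if i \<le> Suc m then v i + c * y ^ i else w i)" for y c
      proof -
        define A where "A i = (if i \<le> Suc m then [:v i, y ^ i:] else [:w i:])" for i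
        have "Z (\<lambda>i. poly (A i) x)" if "x \<in> range of_nat" for x
        proof -
          from that obtain k where "x = of_nat k" by auto
          then show ?thesis
            using step.IH P_add_mult[OF v, of k y] by (auto simp: A_def)
        qed
        then have "Z (\<lambda>i. poly (A i) c)"
          by (rule Z_curve[OF infinite_range_of_nat_fps])
        also have "(\<lambda>i. poly (A i) c) = (\<lambda>i. if i \<le> Suc m then v i + c * y ^ i else w i)"
          by (auto simp: A_def)
        finally show ?thesis .
      qed
      \<comment> \<open>At a nonzero constant \<open>s\<close> this curve adjoins the letter
        \<open>1/s\<close> with multiplicity \<open>c' s^(m+1)\<close>. At 0 the only coordinate up
        to \<open>m + 1\<close> that moves is the last, and it becomes
        \<open>w (Suc m)\<close>.\<close>
      define A where "A i = (if i \<le> Suc m then [:v i:] + monom c' (Suc m - i) else [:w i:])" for i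
      have "Z (\<lambda>i. poly (A i) x)" if "x \<in> fps_const ` (UNIV - {0})" for x
      proof -
        from that obtain s where s: "s \<noteq> 0" "x = fps_const s" by auto
        have "c' * x ^ (Suc m - i) = (c' * x ^ Suc m) * fps_const (1 / s) ^ i" if "i \<le> Suc m" for i
        proof -
          have "x ^ Suc m = x ^ (Suc m - i) * x ^ i"
            using that by (simp flip: power_add)
          moreover have "x ^ i * fps_const (1 / s) ^ i = 1"
            using s by (simp flip: power_mult_distrib)
          ultimately show ?thesis
            by (simp add: mult.assoc)
        qed
        then have "(\<lambda>i. poly (A i) x) =
            (\<lambda>i. if i \<le> Suc m then v i + (c' * x ^ Suc m) * fps_const (1 / s) ^ i else w i)"
          by (auto simp: A_def poly_monom)
        then show ?thesis
          using letters by simp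
      qed
      then have "Z (\<lambda>i. poly (A i) 0)"
      proof (rule Z_curve[rotated])
        have "inj_on fps_const (UNIV - {0 :: rat})"
          by (auto intro: inj_onI)
        then show "infinite (fps_const ` (UNIV - {0 :: rat}))"
          by (simp add: finite_image_iff infinite_UNIV_char_0)
      qed
      moreover have "poly (A i) 0 = w i" if "1 \<le> i" for i
        using that w by (auto simp: A_def c'_def poly_monom zero_power le_Suc_eq)
      ultimately show "Z w"
        using Z_cong[of "\<lambda>i. poly (A i) 0" w] by simp
    qed
  qed
  have "P (\<lambda>m. \<Sum>j=1..L. 0 ^ m)"
    unfolding P_def by (intro exI[of _ L] conjI exI[of _ "\<lambda>_. 0"] order_refl refl)
  then have "Z w" for w
    using Z_above[of 0] by auto
  then show ?thesis
    using symeval_vanishing_imp_zero unfolding Z_def by blast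
qed

section \<open>Generating functions and partial fractions\<close>

definition geometric :: "'a::comm_ring_1 \<Rightarrow> 'a fps" where
  "geometric c = Abs_fps (\<lambda>m. c ^ m)"

lemma geometric_nth [simp]: "geometric c $ m = c ^ m"
  by (simp add: geometric_def)

lemma geometric_mult_linear: "geometric c * (1 - fps_const c * fps_X) = 1"
proof (rule fps_ext)
  fix m
  show "(geometric c * (1 - fps_const c * fps_X)) $ m = 1 $ m"
    by (cases m) (simp_all add: right_diff_distrib mult.left_commute[of "geometric c"])
qed

lemma fps_deriv_linear:
  "fps_deriv (1 - fps_const c * fps_X :: 'a::comm_ring_1 fps) =
     (- fps_const c * geometric c) * (1 - fps_const c * fps_X)"
  by (simp add: mult.assoc geometric_mult_linear)

lemma fps_deriv_geometric: "fps_deriv (geometric c) = (fps_const c * geometric c) * geometric c"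
proof (rule fps_ext)
  fix m
  have "(geometric c * geometric c) $ m = (\<Sum>i=0..m. c ^ m)"
    unfolding fps_mult_nth by (intro sum.cong) (simp_all flip: power_add)
  then show "fps_deriv (geometric c) $ m = ((fps_const c * geometric c) * geometric c) $ m"
    by (simp only: mult.assoc fps_mult_left_const_nth) (simp add: algebra_simps)
qed

lemma fps_log_deriv_mult:
  fixes F G :: "'a::comm_ring_1 fps"
  assumes "fps_deriv F = P * F" "fps_deriv G = R * G"
  shows "fps_deriv (F * G) = (P + R) * (F * G)"
  by (simp add: assms algebra_simps)

lemma fps_log_deriv_prod:
  fixes F :: "'i \<Rightarrow> 'a::comm_ring_1 fps"
  assumes "\<And>i. i \<in> S \<Longrightarrow> fps_deriv (F i) = P i * F i"
  shows "fps_deriv (\<Prod>i\<in>S. F i) = (\<Sum>i\<in>S. P i) * (\<Prod>i\<in>S. F i)"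
  using assms
  by (induction S rule: infinite_finite_induct) (simp_all add: algebra_simps)

definition q_series :: "'a::comm_ring_1 \<Rightarrow> (nat \<Rightarrow> 'a) \<Rightarrow> nat set \<Rightarrow> 'a fps" where
  "q_series t x S = (\<Prod>j\<in>S. (1 - fps_const (t * x j) * fps_X) * geometric (x j))"

text \<open>Each letter \<open>x\<close> contributes \<open>x/(1 - x u) - t x/(1 - t x u)\<close> to
  the logarithmic derivative, with coefficient \<open>(1 - t^(i+1)) x^(i+1)\<close> at
  \<open>u^i\<close>.\<close>

lemma symeval_q_fun_letters:
  fixes \<phi> :: "rat fps \<Rightarrow> 'b::idom"
  assumes "ring_morphism \<phi>"
  shows "symeval \<phi> (\<lambda>m. \<Sum>j\<in>S. x j ^ m) (q_fun m) = q_series (\<phi> fps_X) x S $ m"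
proof (rule symeval_q_fun[OF assms])
  let ?t = "\<phi> fps_X"
  show "q_series ?t x S $ 0 = 1"
    by (induction S rule: infinite_finite_induct) (simp_all add: q_series_def)
  show "fps_deriv (q_series ?t x S) =
      (\<Sum>j\<in>S. - fps_const (?t * x j) * geometric (?t * x j) + fps_const (x j) * geometric (x j)) *
      q_series ?t x S"
    unfolding q_series_def
    by (intro fps_log_deriv_prod fps_log_deriv_mult fps_deriv_linear fps_deriv_geometric)
  show "(\<Sum>j\<in>S. - fps_const (?t * x j) * geometric (?t * x j) + fps_const (x j) * geometric (x j)) $ i =
      (1 - ?t ^ Suc i) * (\<Sum>j\<in>S. x j ^ Suc i)" for i
    by (simp add: fps_sum_nth sum_distrib_left algebra_simps power_mult_distrib)
qed

text \<open>The weight of \<open>x_i u/(1 - x_i u)\<close> in the partial fraction expansion of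
  \<open>q_series\<close>.\<close>

definition hl_g :: "'a::field \<Rightarrow> (nat \<Rightarrow> 'a) \<Rightarrow> nat set \<Rightarrow> nat \<Rightarrow> 'a" where
  "hl_g t x S i = (1 - t) * (\<Prod>j\<in>S - {i}. (x i - t * x j) / (x i - x j))"

lemma degree_prod_linear_le:
  fixes a :: "nat \<Rightarrow> 'a::comm_ring_1"
  shows "degree (\<Prod>j\<in>S. [:1, a j:]) \<le> card S"
proof (cases "finite S")
  case True
  then have "degree (\<Prod>j\<in>S. [:1, a j:]) \<le> (\<Sum>j\<in>S. degree [:1, a j:])"
    using degree_prod_sum_le[of S "\<lambda>j. [:1, a j:]"] by (simp add: comp_def)
  also have "\<dots> \<le> (\<Sum>j\<in>S. 1)"
    by (intro sum_mono) simp
  finally show ?thesis by simp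
qed simp

lemma coeff_prod_linear_top:
  fixes a :: "nat \<Rightarrow> 'a::comm_ring_1"
  assumes "finite S"
  shows "coeff (\<Prod>j\<in>S. [:1, a j:]) (card S) = (\<Prod>j\<in>S. a j)"
  using assms
proof (induction S rule: finite_induct)
  case (insert i S)
  have "coeff (\<Prod>j\<in>S. [:1, a j:]) (Suc (card S)) = 0"
    by (intro coeff_eq_0 le_imp_less_Suc degree_prod_linear_le)
  then show ?case
    using insert by simp
qed simp

context
  fixes t :: "'a::field" and x :: "nat \<Rightarrow> 'a" and S :: "nat set"
  assumes S: "finite S" and inj: "inj_on x S" and nz: "\<And>i. i \<in> S \<Longrightarrow> x i \<noteq> 0"
begin

text \<open>Both sides have degree at most \<open>card S\<close>, so agreement at the
  \<open>card S + 1\<close> points 0 and \<open>1/x_i\<close> suffices. Divided by the product of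
  the \<open>1 - x_j u\<close>, this expands \<open>q_series\<close> as
  \<open>1 + \<Sum>_i g_i x_i u/(1 - x_i u)\<close>.\<close>

lemma hl_partial_fractions:
  "(\<Prod>j\<in>S. [:1, - (t * x j):]) =
     (\<Prod>j\<in>S. [:1, - x j:]) +
     (\<Sum>i\<in>S. smult (hl_g t x S i * x i) ([:0, 1:] * (\<Prod>j\<in>S - {i}. [:1, - x j:])))"
  (is "?l = ?r")
proof (rule poly_eqI_degree)
  let ?A = "insert 0 ((\<lambda>i. inverse (x i)) ` S)"
  have "inj_on (\<lambda>i. inverse (x i)) S"
    using inj by (auto simp: inj_on_def)
  then have card: "card ?A = Suc (card S)"
    using S nz by (subst card_insert_disjoint) (auto simp: card_image)
  show "card ?A > degree ?l"
    unfolding card by (intro le_imp_less_Suc degree_prod_linear_le)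
  have "degree (smult c ([:0, 1:] * (\<Prod>j\<in>S - {i}. [:1, - x j:]))) \<le> card S" if "i \<in> S" for i c
  proof -
    have "degree ([:0, 1:] * (\<Prod>j\<in>S - {i}. [:1, - x j:])) \<le>
        degree [:0, 1 :: 'a:] + degree (\<Prod>j\<in>S - {i}. [:1, - x j:])"
      by (rule degree_mult_le)
    also have "\<dots> \<le> 1 + card (S - {i})"
      by (intro add_mono degree_prod_linear_le) simp
    also have "\<dots> = card S"
      using card_Suc_Diff1[OF S that] by simp
    finally show ?thesis
      by (rule order_trans[OF degree_smult_le])
  qed
  then have "degree ?r \<le> card S"
    by (intro degree_add_le degree_prod_linear_le degree_sum_le S)
  then show "card ?A > degree ?r"
    unfolding card by (simp add: le_imp_less_Suc)
  fix u assume "u \<in> ?A"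
  then show "poly ?l u = poly ?r u"
  proof
    assume "u = 0"
    then show ?thesis
      by (simp add: poly_prod poly_sum)
  next
    assume "u \<in> (\<lambda>i. inverse (x i)) ` S"
    then obtain k where k: "k \<in> S" and u: "u = inverse (x k)" by auto
    have xk: "x k \<noteq> 0" by (rule nz[OF k])
    have "1 - u * (t * x j) = (x k - t * x j) / (x k - x j) * (1 - u * x j)"
      if "j \<in> S - {k}" for j
    proof -
      have "x k \<noteq> x j"
        using inj k that by (auto simp: inj_on_def)
      then show ?thesis
        using xk by (simp add: u field_simps)
    qed
    then have "(\<Prod>j\<in>S - {k}. 1 - u * (t * x j)) =
        (\<Prod>j\<in>S - {k}. (x k - t * x j) / (x k - x j)) * (\<Prod>j\<in>S - {k}. 1 - u * x j)"
      unfolding prod.distrib[symmetric] by (intro prod.cong refl)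
    moreover have "poly ?l u = (1 - u * (t * x k)) * (\<Prod>j\<in>S - {k}. 1 - u * (t * x j))"
      unfolding poly_prod by (subst prod.remove[OF S k]) (simp add: minus_mult_right[symmetric])
    moreover have "u * (t * x k) = t"
      using xk by (simp add: u)
    ultimately have l: "poly ?l u = hl_g t x S k * (\<Prod>j\<in>S - {k}. 1 - u * x j)"
      by (simp add: hl_g_def)
    \<comment> \<open>At \<open>u = 1/x_k\<close> the only term on the right without the factor
      \<open>1 - u x_k\<close> is the summand for \<open>k\<close>.\<close>
    have "poly (\<Prod>j\<in>S. [:1, - x j:]) u = 0"
      unfolding poly_prod using S k xk by (auto simp: prod_zero_iff u intro!: bexI[of _ k])
    moreover have "poly (smult (hl_g t x S i * x i) ([:0, 1:] * (\<Prod>j\<in>S - {i}. [:1, - x j:]))) u =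
        (if i = k then hl_g t x S k * (\<Prod>j\<in>S - {k}. 1 - u * x j) else 0)" if "i \<in> S" for i
    proof (cases "i = k")
      case True
      then show ?thesis using xk by (simp add: poly_prod u)
    next
      case False
      then have "(\<Prod>j\<in>S - {i}. 1 - u * x j) = 0"
        using S k xk by (intro prod_zero bexI[of _ k]) (auto simp: u)
      then show ?thesis using False by (simp add: poly_prod)
    qed
    ultimately have "poly ?r u = hl_g t x S k * (\<Prod>j\<in>S - {k}. 1 - u * x j)"
      using S k by (simp add: poly_sum)
    with l show ?thesis by simp
  qed
qed

text \<open>Comparing the coefficients of \<open>u^(card S)\<close> in the partial fraction identity
  leaves a common factor, the product of the \<open>- x_j\<close>, which is nonzero.\<close>

lemma sum_hl_g: "(\<Sum>i\<in>S. hl_g t x S i) = 1 - t ^ card S"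
proof -
  let ?c = "\<Prod>j\<in>S. - x j"
  have "coeff (smult (hl_g t x S i * x i) ([:0, 1:] * (\<Prod>j\<in>S - {i}. [:1, - x j:]))) (card S) =
      - hl_g t x S i * ?c" if "i \<in> S" for i
  proof -
    have "card S = Suc (card (S - {i}))"
      using card_Suc_Diff1[OF S that] by simp
    then have "coeff ([:0, 1:] * (\<Prod>j\<in>S - {i}. [:1, - x j:])) (card S) =
        coeff (\<Prod>j\<in>S - {i}. [:1, - x j:]) (card (S - {i}))"
      by simp
    also have "\<dots> = (\<Prod>j\<in>S - {i}. - x j)"
      using S by (intro coeff_prod_linear_top) simp
    finally show ?thesis
      unfolding coeff_smult prod.remove[OF S that] by simp
  qed
  then have "coeff (\<Prod>j\<in>S. [:1, - (t * x j):]) (card S) = ?c + (\<Sum>i\<in>S. - hl_g t x S i * ?c)"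
    unfolding hl_partial_fractions coeff_add coeff_sum coeff_prod_linear_top[OF S] by simp
  moreover have "coeff (\<Prod>j\<in>S. [:1, - (t * x j):]) (card S) = t ^ card S * ?c"
    unfolding coeff_prod_linear_top[OF S]
    by (subst minus_mult_right) (simp only: prod.distrib prod_constant)
  ultimately have "t ^ card S * ?c = (1 - (\<Sum>i\<in>S. hl_g t x S i)) * ?c"
    by (simp add: left_diff_distrib sum_distrib_right sum_negf)
  moreover have "?c \<noteq> 0"
    using S nz by simp
  ultimately show ?thesis by simp
qed

text \<open>Dividing the partial fraction identity by all \<open>1 - x_j u\<close> leaves one
  geometric series per letter. The case \<open>m = 0\<close> is different: the left side is 1, while
  the \<open>g_i\<close> sum to \<open>1 - t^(card S)\<close>.\<close>

lemma q_series_nth_eq: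
  assumes "m \<ge> 1"
  shows "q_series t x S $ m = (\<Sum>i\<in>S. hl_g t x S i * x i ^ m)"
proof -
  have lin: "fps_of_poly [:1, - c:] = 1 - fps_const c * fps_X" for c :: 'a
    by (rule fps_ext) (auto simp: coeff_pCons split: nat.split)
  have X: "fps_of_poly [:0, 1:] = (fps_X :: 'a fps)"
    by (simp add: fps_of_poly_pCons)
  have geo: "(\<Prod>j\<in>T. 1 - fps_const (x j) * fps_X) * (\<Prod>j\<in>T. geometric (x j)) = 1" for T
    unfolding prod.distrib[symmetric]
    by (intro prod.neutral ballI) (metis geometric_mult_linear mult.commute)
  have "q_series t x S = fps_of_poly (\<Prod>j\<in>S. [:1, - (t * x j):]) * (\<Prod>j\<in>S. geometric (x j))"
    by (simp add: q_series_def fps_of_poly_prod lin prod.distrib)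
  also have "\<dots> = 1 + (\<Sum>i\<in>S. fps_const (hl_g t x S i * x i) * fps_X *
      ((\<Prod>j\<in>S - {i}. 1 - fps_const (x j) * fps_X) * (\<Prod>j\<in>S. geometric (x j))))"
    unfolding hl_partial_fractions
    by (simp only: fps_of_poly_add fps_of_poly_sum fps_of_poly_smult fps_of_poly_mult
        fps_of_poly_prod lin geo distrib_right sum_distrib_right mult.assoc X)
  also have "\<dots> = 1 + (\<Sum>i\<in>S. fps_const (hl_g t x S i * x i) * fps_X * geometric (x i))"
  proof (intro arg_cong2[of _ _ _ _ "(+)"] refl sum.cong)
    fix i assume "i \<in> S"
    then have "(\<Prod>j\<in>S. geometric (x j)) = (\<Prod>j\<in>S - {i}. geometric (x j)) * geometric (x i)"
      using S by (simp add: prod.remove[of S i] mult.commute)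
    then show "fps_const (hl_g t x S i * x i) * fps_X *
        ((\<Prod>j\<in>S - {i}. 1 - fps_const (x j) * fps_X) * (\<Prod>j\<in>S. geometric (x j))) =
      fps_const (hl_g t x S i * x i) * fps_X * geometric (x i)"
      using geo[of "S - {i}"] by (simp add: mult.assoc[symmetric])
  qed
  finally show ?thesis
    using assms by (cases m) (simp_all add: fps_sum_nth mult.assoc)
qed

end

section \<open>The symmetrisation formula\<close>

text \<open>The summand of \<open>hl_R\<close> for the ordering \<open>xs\<close> of the letters,
  made recursive so that the first letter splits off. As \<open>tl [] = []\<close>, a short \<mu> is
  padded by zero parts.\<close>

fun hl_term :: "'a::field \<Rightarrow> (nat \<Rightarrow> 'a) \<Rightarrow> nat list \<Rightarrow> nat list \<Rightarrow> 'a" where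
  "hl_term t x [] \<mu> = 1"
| "hl_term t x (i # xs) \<mu> =
     x i ^ part \<mu> 1 * (\<Prod>j\<in>set xs. (x i - t * x j) / (x i - x j)) * hl_term t x xs (tl \<mu>)"

definition hl_sum :: "'a::field \<Rightarrow> (nat \<Rightarrow> 'a) \<Rightarrow> nat set \<Rightarrow> nat list \<Rightarrow> 'a" where
  "hl_sum t x S \<mu> = (\<Sum>xs\<in>permutations_of_set S. hl_term t x xs \<mu>)"

lemma part_tl: "part (tl \<mu>) (Suc i) = part \<mu> (Suc (Suc i))"
  by (cases \<mu>) (simp_all add: part_def)

lemma part_Cons_Suc: "1 \<le> i \<Longrightarrow> part (m # \<mu>) (Suc i) = part \<mu> i"
  by (cases i) (simp_all add: part_def)

lemma part_Cons_1: "part (m # \<mu>) (Suc 0) = m"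
  by (simp add: part_def)

lemma hl_term_eq_prod:
  "distinct xs \<Longrightarrow> hl_term t x xs \<mu> =
     (\<Prod>i<length xs. x (xs ! i) ^ part \<mu> (Suc i)) *
     (\<Prod>i<length xs. \<Prod>j\<in>{i<..<length xs}.
        (x (xs ! i) - t * x (xs ! j)) / (x (xs ! i) - x (xs ! j)))"
proof (induction xs arbitrary: \<mu>)
  case (Cons a xs)
  let ?r = "\<lambda>i j. (x i - t * x j) / (x i - x j)"
  have Suc_image: "{Suc i<..<Suc n} = Suc ` {i<..<n}" for i n :: nat
    by (auto simp: image_iff Bex_def) presburger
  have "{0<..<Suc (length xs)} = Suc ` {..<length xs}"
    by (auto simp: image_iff Bex_def) presburger
  then have "(\<Prod>j\<in>{0<..<Suc (length xs)}. ?r a ((a # xs) ! j)) = (\<Prod>j<length xs. ?r a (xs ! j))"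
    by (simp add: prod.reindex)
  also have "\<dots> = (\<Prod>j\<in>set xs. ?r a j)"
    using Cons.prems bij_betw_nth[of xs "{..<length xs}" "set xs"]
    by (intro prod.reindex_bij_betw) simp
  finally have head: "(\<Prod>j\<in>{0<..<Suc (length xs)}. ?r a ((a # xs) ! j)) = (\<Prod>j\<in>set xs. ?r a j)" .
  show ?case
    using Cons
    by (simp add: prod.lessThan_Suc_shift Suc_image prod.reindex head part_tl mult_ac
        del: prod.lessThan_Suc nth_Cons_pos)
qed simp

lemma bij_betw_permutes_lists:
  "bij_betw (\<lambda>w. map w [1..<Suc N]) {w. w permutes {1..N}} (permutations_of_set {1..N})"
proof -
  let ?F = "\<lambda>w :: nat \<Rightarrow> nat. map w [1..<Suc N]"
  have inj: "inj_on ?F {w. w permutes {1..N}}"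
  proof (rule inj_onI, rule ext)
    fix v w i
    assume vw: "v \<in> {w. w permutes {1..N}}" "w \<in> {w. w permutes {1..N}}" "?F v = ?F w"
    show "v i = w i"
    proof (cases "i \<in> {1..N}")
      case True
      then have "i \<in> set [1..<Suc N]" by auto
      with vw(3) show ?thesis
        using map_eq_conv[of v "[1..<Suc N]" w] by blast
    next
      case False
      then show ?thesis
        using vw(1,2) permutes_not_in[of v "{1..N}" i] permutes_not_in[of w "{1..N}" i] by simp
    qed
  qed
  have "?F ` {w. w permutes {1..N}} = permutations_of_set {1..N}"
  proof (rule card_subset_eq)
    show "?F ` {w. w permutes {1..N}} \<subseteq> permutations_of_set {1..N}"
    proof safe
      fix w assume w: "w permutes {1..N}"
      have "set [1..<Suc N] = {1..N}" by auto
      then show "?F w \<in> permutations_of_set {1..N}"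
        using permutes_image[OF w] permutes_inj_on[OF w, of "{1..N}"]
        by (intro permutations_of_setI) (simp_all only: set_map distinct_map distinct_upt simp_thms)
    qed
    show "card (?F ` {w. w permutes {1..N}}) = card (permutations_of_set {1..N})"
      using card_permutations[of "{1..N}" N] by (simp only: card_image[OF inj]) simp
  qed simp
  with inj show ?thesis
    by (simp only: bij_betw_def)
qed

lemma hl_R_eq_hl_sum: "hl_R t x N \<mu> = hl_sum t x {1..N} \<mu>"
proof -
  have Suc_image: "{Suc i<..N} = Suc ` {i<..<N}" for i
    by (auto simp: image_iff Bex_def) presburger
  have "(\<Prod>i=1..N. x (w i) ^ part \<mu> i) *
        (\<Prod>i=1..N. \<Prod>j\<in>{i<..N}. (x (w i) - t * x (w j)) / (x (w i) - x (w j))) =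
      hl_term t x (map w [1..<Suc N]) \<mu>" if w: "w permutes {1..N}" for w
  proof -
    have "map w [1..<Suc N] \<in> permutations_of_set {1..N}"
      using bij_betwE[OF bij_betw_permutes_lists[of N]] w by blast
    then have "distinct (map w [1..<Suc N])"
      by (rule permutations_of_setD)
    then show ?thesis
      by (subst hl_term_eq_prod)
        (simp_all add: prod.atLeast1_atMost_eq Suc_image prod.reindex nth_append del: upt_Suc)
  qed
  then show ?thesis
    unfolding hl_R_def hl_sum_def
    by (subst sum.reindex_bij_betw[OF bij_betw_permutes_lists[of N], symmetric]) simp
qed

lemma hl_sum_rec:
  assumes "finite S" "S \<noteq> {}"
  shows "hl_sum t x S \<mu> = (\<Sum>i\<in>S. x i ^ part \<mu> 1 *
    (\<Prod>j\<in>S - {i}. (x i - t * x j) / (x i - x j)) * hl_sum t x (S - {i}) (tl \<mu>))"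
proof -
  have "hl_sum t x S \<mu> =
      (\<Sum>i\<in>S. \<Sum>xs\<in>(#) i ` permutations_of_set (S - {i}). hl_term t x xs \<mu>)"
    unfolding hl_sum_def permutations_of_set_nonempty[OF assms(2)]
    using assms(1) by (subst sum.UNION_disjoint) auto
  also have "\<dots> = (\<Sum>i\<in>S. \<Sum>xs\<in>permutations_of_set (S - {i}). hl_term t x (i # xs) \<mu>)"
    by (simp add: sum.reindex)
  also have "\<dots> = (\<Sum>i\<in>S. x i ^ part \<mu> 1 *
      (\<Prod>j\<in>S - {i}. (x i - t * x j) / (x i - x j)) * hl_sum t x (S - {i}) (tl \<mu>))"
    unfolding hl_sum_def sum_distrib_left
    by (intro sum.cong refl) (simp add: permutations_of_setD)
  finally show ?thesis .
qed

text \<open>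
  \<open>b\<^sub>\<mu>/v\<^sub>\<mu>\<close> depends only on \<open>N\<close> and the multiplicity of the part \<open>0\<close>; this form is also defined for an
  arbitrary index set in place of \<open>{1..N}\<close>, which allows induction by removing letters.
\<close>

definition hl_QS :: "'a::field \<Rightarrow> (nat \<Rightarrow> 'a) \<Rightarrow> nat set \<Rightarrow> nat list \<Rightarrow> 'a" where
  "hl_QS t x S \<mu> =
     (1 - t) ^ card S / (\<Prod>i=1..part_mult (card S) \<mu> 0. 1 - t ^ i) * hl_sum t x S \<mu>"

text \<open>The multiplicities add up to \<open>N\<close>, so the denominators in
  \<open>hl_v\<close> combine to \<open>(1 - t)^N\<close>; \<open>hl_b\<close> cancels all other
  factors except those of the part 0.\<close>

lemma hl_Q_eq_hl_QS:
  assumes t: "\<And>i. i \<ge> 1 \<Longrightarrow> t ^ i \<noteq> 1"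
  shows "hl_Q t x N \<mu> = hl_QS t x {1..N} \<mu>"
proof -
  let ?A = "part \<mu> ` {1..N}"
  let ?m = "part_mult N \<mu>"
  let ?f = "\<lambda>a. \<Prod>i=1..?m a. 1 - t ^ i"
  have t1: "1 - t \<noteq> 0"
    using t[of 1] by simp
  have f: "?f a \<noteq> 0" for a
    using t by (auto simp: prod_zero_iff)
  have "(\<Sum>a\<in>?A. ?m a) = card (\<Union>a\<in>?A. {i \<in> {1..N}. part \<mu> i = a})"
    unfolding part_mult_def by (subst card_UN_disjoint) auto
  also have "(\<Union>a\<in>?A. {i \<in> {1..N}. part \<mu> i = a}) = {1..N}"
    by auto
  finally have sum_m: "(\<Sum>a\<in>?A. ?m a) = N"
    by simp
  have "hl_v t N \<mu> = (\<Prod>a\<in>?A. ?f a / (1 - t) ^ ?m a)"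
    unfolding hl_v_def by (intro prod.cong refl) (simp add: prod_dividef)
  also have "\<dots> = (\<Prod>a\<in>?A. ?f a) / (1 - t) ^ N"
    unfolding prod_dividef power_sum[symmetric] sum_m ..
  also have "(\<Prod>a\<in>?A. ?f a) = hl_b t N \<mu> * ?f 0"
  proof (cases "0 \<in> ?A")
    case True
    then show ?thesis
      unfolding hl_b_def by (subst prod.remove[of ?A 0]) (auto simp: mult.commute)
  next
    case False
    then have "?m 0 = 0"
      by (auto simp: part_mult_def)
    then show ?thesis
      using False by (simp add: hl_b_def)
  qed
  finally have v: "hl_v t N \<mu> = hl_b t N \<mu> * ?f 0 / (1 - t) ^ N" .
  have "hl_b t N \<mu> \<noteq> 0"
    unfolding hl_b_def by (subst prod_zero_iff) (use f in blast)+
  then show ?thesis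
    using t1 f[of 0] unfolding hl_Q_def hl_P_def hl_QS_def v hl_R_eq_hl_sum by simp
qed

text \<open>Since \<open>m \<ge> 1\<close>, prepending \<open>m\<close> while adding one letter
  keeps the multiplicity of the part 0. The normalisations then differ by one factor
  \<open>1 - t\<close>, which \<open>hl_g\<close> absorbs.\<close>

lemma hl_QS_Cons:
  assumes S: "finite S" "S \<noteq> {}" and "m \<ge> 1"
  shows "hl_QS t x S (m # \<mu>) = (\<Sum>i\<in>S. hl_g t x S i * x i ^ m * hl_QS t x (S - {i}) \<mu>)"
proof -
  obtain N where N: "card S = Suc N"
    using S by (metis card_gt_0_iff gr0_implies_Suc)
  have "{i \<in> {1..Suc N}. part (m # \<mu>) i = 0} = Suc ` {i \<in> {1..N}. part \<mu> i = 0}"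
  proof (intro equalityI subsetI)
    fix i assume i: "i \<in> {i \<in> {1..Suc N}. part (m # \<mu>) i = 0}"
    then obtain k where k: "i = Suc k"
      by (cases i) auto
    with i \<open>m \<ge> 1\<close> have "k \<ge> 1"
      by (cases k) (auto simp: part_Cons_1)
    with i k show "i \<in> Suc ` {i \<in> {1..N}. part \<mu> i = 0}"
      by (auto simp: part_Cons_Suc)
  qed (auto simp: part_Cons_Suc)
  then have mult: "part_mult (Suc N) (m # \<mu>) 0 = part_mult N \<mu> 0"
    unfolding part_mult_def by (simp add: card_image)
  have card: "card (S - {i}) = N" if "i \<in> S" for i
    using that S N by simp
  show ?thesis
    unfolding hl_QS_def hl_sum_rec[OF S] hl_g_def N mult sum_distrib_left
    by (intro sum.cong refl) (simp add: card part_Cons_1 mult_ac del: card_Diff_insert)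
qed

text \<open>Splitting off the first of \<open>N\<close> letters yields the factor
  \<open>1 - t^N\<close> by \<open>sum_hl_g\<close>; these factors multiply to the normalising
  denominator.\<close>

lemma hl_QS_zero:
  assumes t: "\<And>i. i \<ge> 1 \<Longrightarrow> t ^ i \<noteq> 1"
    and "finite S" "inj_on x S" "\<And>i. i \<in> S \<Longrightarrow> x i \<noteq> 0"
    and \<mu>: "\<And>i. part \<mu> i = 0"
  shows "hl_QS t x S \<mu> = 1"
proof -
  have "(1 - t) ^ card S * hl_sum t x S \<mu> = (\<Prod>i=1..card S. 1 - t ^ i)"
    using assms(2-)
  proof (induction "card S" arbitrary: S \<mu>)
    case 0
    then show ?case by (simp add: hl_sum_def)
  next
    case (Suc N)
    then have S: "finite S" "S \<noteq> {}" by auto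
    have tl: "part (tl \<mu>) i = 0" for i
      using Suc.prems(4) by (cases i) (auto simp: part_tl part_def[of _ 0])
    have "(1 - t) ^ Suc N * hl_sum t x S \<mu> =
        (\<Sum>i\<in>S. hl_g t x S i * ((1 - t) ^ N * hl_sum t x (S - {i}) (tl \<mu>)))"
      unfolding hl_sum_rec[OF S] hl_g_def sum_distrib_left
      by (intro sum.cong refl) (simp add: Suc.prems(4))
    also have "\<dots> = (\<Sum>i\<in>S. hl_g t x S i * (\<Prod>i=1..N. 1 - t ^ i))"
    proof (intro sum.cong refl)
      fix i assume "i \<in> S"
      then have N: "N = card (S - {i})"
        using Suc.hyps(2) S by simp
      have "(1 - t) ^ card (S - {i}) * hl_sum t x (S - {i}) (tl \<mu>) =
          (\<Prod>i=1..card (S - {i}). 1 - t ^ i)"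
        using Suc.prems tl by (intro Suc.hyps(1)[OF N]) (auto intro: inj_on_subset)
      then show "hl_g t x S i * ((1 - t) ^ N * hl_sum t x (S - {i}) (tl \<mu>)) =
          hl_g t x S i * (\<Prod>i=1..N. 1 - t ^ i)"
        by (simp only: N[symmetric])
    qed
    also have "\<dots> = (1 - t ^ Suc N) * (\<Prod>i=1..N. 1 - t ^ i)"
      using sum_hl_g[OF Suc.prems(1-3), of t] Suc.hyps(2) by (simp add: sum_distrib_right[symmetric])
    finally show ?case
      by (simp add: Suc.hyps(2)[symmetric])
  qed
  moreover have "part_mult (card S) \<mu> 0 = card S"
  proof -
    have "{i \<in> {1..card S}. part \<mu> i = 0} = {1..card S}"
      using \<mu> by auto
    then show ?thesis
      by (simp only: part_mult_def) simp
  qed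
  moreover have "(\<Prod>i=1..card S. 1 - t ^ i) \<noteq> 0"
    using t by (auto simp: prod_zero_iff)
  ultimately show ?thesis
    by (simp add: hl_QS_def)
qed

section \<open>The recursion for \<open>Q\<^sub>\<mu>\<close>\<close>

definition fract_scalar :: "rat fps \<Rightarrow> xpoly fract" where
  "fract_scalar c = to_fract (scalar c)"

definition fract_indet :: "nat \<Rightarrow> xpoly fract" where
  "fract_indet j = to_fract (indet j)"

lemma ring_morphism_fract_scalar: "ring_morphism fract_scalar"
  unfolding fract_scalar_def
  by (rule ring_morphism_comp[OF ring_morphism_to_fract ring_morphism_scalar])

interpretation fract_scalar: ring_morphism fract_scalar
  by (rule ring_morphism_fract_scalar)

lemma fract_scalar_X_power_neq_1:
  assumes "i \<ge> 1"
  shows "fract_scalar fps_X ^ i \<noteq> 1"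
proof
  assume "fract_scalar fps_X ^ i = 1"
  then have "fract_scalar (fps_X ^ i) = fract_scalar 1"
    by (simp only: fract_scalar.power fract_scalar.one)
  then have "fps_X ^ i = (1 :: rat fps)"
    by (simp only: fract_scalar_def scalar_def to_fract_eq_iff inj_eq[OF inj_single])
  moreover have "(fps_X ^ i :: rat fps) $ 0 = 0"
    using assms by (simp add: fps_X_power_nth)
  ultimately have "(1 :: rat fps) $ 0 = 0"
    by (simp only:)
  then show False by simp
qed

lemma inj_fract_indet: "inj fract_indet"
proof (rule injI)
  fix i j
  assume "fract_indet i = fract_indet j"
  then have "Poly_Mapping.keys (indet i) = Poly_Mapping.keys (indet j)"
    by (simp add: fract_indet_def)
  then have "Poly_Mapping.single i (1::nat) = Poly_Mapping.single j 1"
    by (simp add: indet_def)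
  then have "Poly_Mapping.keys (Poly_Mapping.single i (1::nat)) = Poly_Mapping.keys (Poly_Mapping.single j (1::nat))"
    by (rule arg_cong)
  then show "i = j"
    by simp
qed

lemma fract_indet_nonzero: "fract_indet i \<noteq> 0"
proof -
  have "Poly_Mapping.keys (indet i) \<noteq> {}"
    by (simp add: indet_def)
  then show ?thesis
    by (auto simp: fract_indet_def)
qed

text \<open>Arbitrary finite sets of letters take the place of \<open>{1..N}\<close>, because the
  recursion removes any one letter.\<close>

definition represents_Q :: "symfun \<Rightarrow> nat list \<Rightarrow> bool" where
  "represents_Q f \<mu> \<longleftrightarrow> (\<forall>S. finite S \<longrightarrow> length \<mu> \<le> card S \<longrightarrow>
     symeval fract_scalar (\<lambda>m. \<Sum>j\<in>S. fract_indet j ^ m) f =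
       hl_QS (fract_scalar fps_X) fract_indet S \<mu>)"

text \<open>The sets \<open>{1..N}\<close> give the defining property of \<open>HL_Q\<close>. Any
  other solution differs from \<open>f\<close> by a function that vanishes on all large alphabets,
  hence by 0.\<close>

lemma HL_Q_eq:
  assumes "represents_Q f \<mu>"
  shows "HL_Q \<mu> = f"
  unfolding HL_Q_def
proof (rule the_equality)
  have eval: "to_fract (pleth g (alphabet N)) =
      symeval fract_scalar (\<lambda>m. \<Sum>j\<in>{1..N}. fract_indet j ^ m) g" for g N
    unfolding pleth_eq_symeval ring_morphism_symeval_apply[OF ring_morphism_to_fract]
    by (rule symeval_cong)
      (simp_all add: fract_scalar_def fract_indet_def alphabet_def
        ring_morphism.power[OF ring_morphism_to_fract])
  have Q: "hl_Q (to_fract tt) (\<lambda>j. to_fract (indet j)) N \<mu> =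
      hl_QS (fract_scalar fps_X) fract_indet {1..N} \<mu>" for N
    using hl_Q_eq_hl_QS[OF fract_scalar_X_power_neq_1, of fract_indet N \<mu>]
    by (simp add: fract_scalar_def fract_indet_def[abs_def])
  show f: "\<forall>N\<ge>length \<mu>. to_fract (pleth f (alphabet N)) =
      hl_Q (to_fract tt) (\<lambda>j. to_fract (indet j)) N \<mu>"
    using assms unfolding eval Q represents_Q_def by simp
  fix g
  assume g: "\<forall>N\<ge>length \<mu>. to_fract (pleth g (alphabet N)) =
      hl_Q (to_fract tt) (\<lambda>j. to_fract (indet j)) N \<mu>"
  have "pleth (g - f) (alphabet N) = 0" if "N \<ge> length \<mu>" for N
  proof -
    have "to_fract (pleth g (alphabet N)) = to_fract (pleth f (alphabet N))"
      using f g that by metis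
    then show ?thesis
      using ring_morphism.minus[OF ring_morphism_symeval[OF ring_morphism_scalar], of "alphabet N" g f]
      by (simp add: pleth_eq_symeval)
  qed
  then have "g - f = 0"
    by (rule power_sums_algebraically_independent)
  then show "g = f" by simp
qed

text \<open>The coefficient of \<open>u^m\<close> in \<open>q(u) f(X - 1/u)\<close>, with
  \<open>q(u)\<close> generating the \<open>q_m\<close>: Jing's vertex operator.\<close>

definition q_creation :: "nat \<Rightarrow> symfun \<Rightarrow> symfun" where
  "q_creation m f = (\<Sum>j\<le>degree (sym_shift f). q_fun (m + j) * coeff (sym_shift f) j)"

lemma represents_Q_Cons:
  assumes "represents_Q f \<mu>" "m \<ge> 1"
  shows "represents_Q (q_creation m f) (m # \<mu>)"
  unfolding represents_Q_def
proof (intro allI impI)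
  fix S :: "nat set"
  assume S: "finite S" and len: "length (m # \<mu>) \<le> card S"
  let ?t = "fract_scalar fps_X" and ?x = fract_indet
  let ?A = "\<lambda>m. \<Sum>j\<in>S. ?x j ^ m"
  let ?D = "\<lambda>j. symeval fract_scalar ?A (coeff (sym_shift f) j)"
  interpret E: ring_morphism "symeval fract_scalar ?A"
    by (rule ring_morphism_symeval) (rule ring_morphism_fract_scalar)
  have inj: "inj_on ?x S"
    using inj_fract_indet by (rule inj_on_subset) simp
  have "symeval fract_scalar ?A (q_creation m f) =
      (\<Sum>j\<le>degree (sym_shift f). (\<Sum>i\<in>S. hl_g ?t ?x S i * ?x i ^ (m + j)) * ?D j)"
    unfolding q_creation_def E.sum E.mult symeval_q_fun_letters[OF ring_morphism_fract_scalar]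
    using \<open>m \<ge> 1\<close> by (simp add: q_series_nth_eq[OF S inj fract_indet_nonzero])
  also have "\<dots> = (\<Sum>i\<in>S. \<Sum>j\<le>degree (sym_shift f). hl_g ?t ?x S i * ?x i ^ (m + j) * ?D j)"
    unfolding sum_distrib_right by (rule sum.swap)
  \<comment> \<open>For fixed \<open>i\<close> the sum over \<open>j\<close> reassembles
    \<open>f(X - x_i)\<close>.\<close>
  also have "\<dots> = (\<Sum>i\<in>S. hl_g ?t ?x S i * ?x i ^ m *
      symeval fract_scalar (\<lambda>m. ?A m - ?x i ^ m) f)"
    unfolding symeval_shift[OF ring_morphism_fract_scalar] sum_distrib_left
    by (intro sum.cong refl) (simp add: power_add mult_ac)
  also have "\<dots> = (\<Sum>i\<in>S. hl_g ?t ?x S i * ?x i ^ m * hl_QS ?t ?x (S - {i}) \<mu>)"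
  proof (intro sum.cong refl arg_cong2[of _ _ _ _ "(*)"])
    fix i assume i: "i \<in> S"
    have "(\<lambda>m. ?A m - ?x i ^ m) = (\<lambda>m. \<Sum>j\<in>S - {i}. ?x j ^ m)"
      using S i by (simp add: sum_diff1)
    then show "symeval fract_scalar (\<lambda>m. ?A m - ?x i ^ m) f = hl_QS ?t ?x (S - {i}) \<mu>"
      using assms(1) S i len unfolding represents_Q_def by simp
  qed
  also have "\<dots> = hl_QS ?t ?x S (m # \<mu>)"
    using S len \<open>m \<ge> 1\<close> by (intro hl_QS_Cons[symmetric]) auto
  finally show "symeval fract_scalar ?A (q_creation m f) = hl_QS ?t ?x S (m # \<mu>)" .
qed

lemma represents_Q_zero:
  assumes "\<And>i. part \<mu> i = 0"
  shows "represents_Q 1 \<mu>"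
  unfolding represents_Q_def
  using hl_QS_zero[OF fract_scalar_X_power_neq_1 _ inj_on_subset[OF inj_fract_indet]
      fract_indet_nonzero assms]
  by (simp add: ring_morphism.one[OF ring_morphism_symeval[OF ring_morphism_fract_scalar]])

text \<open>Positive parts are added by \<open>q_creation\<close>. A leading 0 may occur because
  trailing zeros are allowed; then all parts are 0 and the representative is 1.\<close>

lemma represents_Q_exists: "is_partition \<mu> \<Longrightarrow> \<exists>f. represents_Q f \<mu>"
proof (induction \<mu>)
  case Nil
  show ?case
    by (rule exI, rule represents_Q_zero) (auto simp: part_def)
next
  case (Cons m \<mu>)
  show ?case
  proof (cases "m \<ge> 1")
    case True
    then show ?thesis
      using Cons represents_Q_Cons by (fastforce simp: is_partition_def)
  next
    case False
    with Cons.prems have "\<forall>a\<in>set (m # \<mu>). a = 0"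
      by (auto simp: is_partition_def)
    then have "part (m # \<mu>) i = 0" for i
      by (auto simp: part_def simp del: set_simps dest: nth_mem)
    then show ?thesis
      using represents_Q_zero by blast
  qed
qed

lemma HL_Q_Cons:
  assumes "is_partition \<mu>" "m \<ge> 1"
  shows "HL_Q (m # \<mu>) = q_creation m (HL_Q \<mu>)"
  using represents_Q_exists[OF assms(1)] represents_Q_Cons[OF _ assms(2)] HL_Q_eq by metis

section \<open>Evaluation at \<open>(t\<^sup>r - X)/(1 - t)\<close>\<close>

definition modified_arg :: "nat \<Rightarrow> nat \<Rightarrow> nat \<Rightarrow> xpoly" where
  "modified_arg r n m = scalar (inverse (1 - fps_X ^ m)) * t_minus_alphabet r n m"

lemma pleth_HL_Q':
  "pleth (HL_Q' \<mu>) (t_minus_alphabet r n) = symeval scalar (modified_arg r n) (HL_Q \<mu>)"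
proof -
  interpret E: ring_morphism "symeval scalar (t_minus_alphabet r n)"
    by (rule ring_morphism_symeval) (rule ring_morphism_scalar)
  show ?thesis
    unfolding HL_Q'_def pleth_eq_symeval ring_morphism_symeval_apply[OF E.ring_morphism_axioms]
    by (rule symeval_cong)
      (simp_all add: symeval_scalar[OF ring_morphism_scalar] symeval_indet[OF ring_morphism_scalar]
        over_one_minus_t_def E.mult modified_arg_def)
qed

lemma scalar_one_minus_X_inverse:
  assumes "m \<ge> 1"
  shows "(1 - tt ^ m) * scalar (inverse (1 - fps_X ^ m)) = 1"
proof -
  interpret scalar: ring_morphism scalar by (rule ring_morphism_scalar)
  have "(1 - fps_X ^ m :: rat fps) $ 0 \<noteq> 0"
    using assms by (simp add: fps_X_power_nth)
  then have "(1 - fps_X ^ m) * inverse (1 - fps_X ^ m) = (1 :: rat fps)"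
    using inverse_mult_eq_1'[of "1 - fps_X ^ m :: rat fps"] by simp
  then have "scalar ((1 - fps_X ^ m) * inverse (1 - fps_X ^ m)) = scalar 1"
    by simp
  then show ?thesis
    by (simp only: scalar.simps)
qed

lemma modified_arg_shift:
  assumes "m \<ge> 1"
  shows "modified_arg r n m - (tt ^ r) ^ m = modified_arg (Suc r) n m"
proof -
  let ?i = "scalar (inverse (1 - fps_X ^ m)) :: xpoly"
  \<comment> \<open>This brings both terms over the denominator \<open>1 - t^m\<close>; then
    \<open>1 - (1 - t^m) = t^m\<close> raises \<open>r\<close> by one.\<close>
  have "(tt ^ r) ^ m = ((1 - tt ^ m) * ?i) * tt ^ (r * m)"
    unfolding scalar_one_minus_X_inverse[OF assms] by (simp add: power_mult)
  then show ?thesis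
    by (simp add: modified_arg_def t_minus_alphabet_def algebra_simps power_add)
qed

text \<open>Multiplication by \<open>1 - x u\<close> turns coefficients \<open>C c^m\<close> into
  \<open>C (c - x) c^(m-1)\<close>, so each letter contributes one factor and delays the geometric
  range by one index.\<close>

lemma geometric_times_prod_nth:
  fixes x :: "nat \<Rightarrow> 'a::comm_ring_1"
  assumes "finite S" "card S \<le> m"
  shows "((\<Prod>j\<in>S. 1 - fps_const (x j) * fps_X) * geometric c) $ m =
    c ^ (m - card S) * (\<Prod>j\<in>S. c - x j)"
  using assms
proof (induction S arbitrary: m rule: finite_induct)
  case (insert i S)
  then obtain k where m: "m = Suc k" and k: "card S \<le> k"
    by (cases m) auto
  let ?G = "(\<Prod>j\<in>S. 1 - fps_const (x j) * fps_X) * geometric c"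
  have "((\<Prod>j\<in>insert i S. 1 - fps_const (x j) * fps_X) * geometric c) = ?G - fps_const (x i) * (fps_X * ?G)"
    using insert.hyps by (simp add: algebra_simps)
  then have "((\<Prod>j\<in>insert i S. 1 - fps_const (x j) * fps_X) * geometric c) $ m = ?G $ Suc k - x i * ?G $ k"
    by (simp add: m)
  also have "\<dots> = c ^ (m - card (insert i S)) * (\<Prod>j\<in>insert i S. c - x j)"
    using insert.hyps insert.IH[of k] insert.IH[of "Suc k"] k
    by (simp add: m Suc_diff_le algebra_simps)
  finally show ?case .
qed simp

text \<open>The factors \<open>1 - t^i\<close> in \<open>q_fun\<close> cancel the denominators of
  the argument, which leaves \<open>h_m(t^r - X)\<close>, the coefficient of \<open>u^m\<close> in
  \<open>(\<Prod>_j (1 - x_j u))/(1 - t^r u)\<close>.\<close>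

lemma symeval_q_fun_modified_arg:
  assumes "n \<le> m"
  shows "symeval scalar (modified_arg r n) (q_fun m) =
    (tt ^ r) ^ (m - n) * (\<Prod>j=1..n. tt ^ r - indet j)"
proof -
  let ?G = "(\<Prod>j=1..n. 1 - fps_const (indet j) * fps_X) * geometric (tt ^ r) :: xpoly fps"
  let ?P = "(\<Sum>j=1..n. - fps_const (indet j) * geometric (indet j)) +
    fps_const (tt ^ r) * geometric (tt ^ r) :: xpoly fps"
  have "symeval scalar (modified_arg r n) (q_fun m) = ?G $ m"
  proof (rule symeval_q_fun[OF ring_morphism_scalar])
    have "(\<Prod>j\<in>S. 1 - fps_const (indet j) * fps_X) $ 0 = (1 :: xpoly)" for S
      by (induction S rule: infinite_finite_induct) simp_all
    then show "?G $ 0 = 1" by simp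
    show "fps_deriv ?G = ?P * ?G"
      by (intro fps_log_deriv_mult fps_log_deriv_prod fps_deriv_linear fps_deriv_geometric)
    fix i
    have "(1 - tt ^ Suc i) * modified_arg r n (Suc i) =
        ((1 - tt ^ Suc i) * scalar (inverse (1 - fps_X ^ Suc i))) * t_minus_alphabet r n (Suc i)"
      by (simp only: modified_arg_def mult.assoc)
    also have "\<dots> = t_minus_alphabet r n (Suc i)"
      by (subst scalar_one_minus_X_inverse) simp_all
    also have "\<dots> = ?P $ i"
      by (simp add: t_minus_alphabet_def alphabet_def fps_sum_nth sum_negf power_add
          flip: power_mult)
    finally show "?P $ i = (1 - tt ^ Suc i) * modified_arg r n (Suc i)" ..
  qed
  then show ?thesis
    using geometric_times_prod_nth[of "{1..n}" m indet "tt ^ r"] assms by simp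
qed

lemma pleth_HL_Q'_large_part:
  assumes "is_partition \<mu>" "n \<ge> 1"
  shows "pleth (HL_Q' ((n + a) # \<mu>)) (t_minus_alphabet r n) =
    tt ^ (r * a) * (\<Prod>j=1..n. tt ^ r - indet j) * pleth (HL_Q' \<mu>) (t_minus_alphabet (Suc r) n)"
proof -
  let ?f = "HL_Q \<mu>" and ?p = "\<Prod>j=1..n. tt ^ r - indet j :: xpoly"
  interpret E: ring_morphism "symeval scalar (modified_arg r n)"
    by (rule ring_morphism_symeval) (rule ring_morphism_scalar)
  have "HL_Q ((n + a) # \<mu>) = q_creation (n + a) ?f"
    using assms by (intro HL_Q_Cons) auto
  \<comment> \<open>All indices \<open>n + a + j\<close> are at least \<open>n\<close>, so every
    \<open>q_fun\<close> value lies in the geometric range.\<close>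
  then have "pleth (HL_Q' ((n + a) # \<mu>)) (t_minus_alphabet r n) =
      (\<Sum>j\<le>degree (sym_shift ?f). ((tt ^ r) ^ (a + j) * ?p) *
        symeval scalar (modified_arg r n) (coeff (sym_shift ?f) j))"
    by (simp add: pleth_HL_Q' q_creation_def E.sum E.mult symeval_q_fun_modified_arg)
  \<comment> \<open>The powers \<open>t^(r j)\<close> reassemble the shift of
    \<open>HL_Q \<mu>\<close> by the single letter \<open>t^r\<close>.\<close>
  also have "\<dots> = tt ^ (r * a) * ?p * symeval scalar (\<lambda>m. modified_arg r n m - (tt ^ r) ^ m) ?f"
    unfolding symeval_shift[OF ring_morphism_scalar] sum_distrib_left power_mult[of tt r a]
    by (intro sum.cong refl) (simp add: power_add mult_ac)
  also have "symeval scalar (\<lambda>m. modified_arg r n m - (tt ^ r) ^ m) ?f =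
      symeval scalar (modified_arg (Suc r) n) ?f"
    by (rule symeval_cong) (rule refl, rule modified_arg_shift, simp)
  finally show ?thesis
    by (simp only: pleth_HL_Q')
qed

lemma weight_Cons: "weight (a # \<mu>) = a + weight \<mu>"
proof -
  have "weight (a # \<mu>) = (\<Sum>i<Suc (length \<mu>). part (a # \<mu>) (Suc i))"
    unfolding weight_def One_nat_def sum.atLeast1_atMost_eq by (simp del: sum.lessThan_Suc)
  also have "\<dots> = a + (\<Sum>i<length \<mu>. part \<mu> (Suc i))"
    by (simp only: sum.lessThan_Suc_shift) (simp add: part_Cons_1 part_Cons_Suc)
  finally show ?thesis
    by (simp add: weight_def sum.atLeast1_atMost_eq)
qed

text \<open>Every part of \<mu> moves one row down, which costs \<open>weight \<mu>\<close>.\<close>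

lemma n_stat_Cons: "n_stat (a # \<mu>) = n_stat \<mu> + weight \<mu>"
proof -
  have "n_stat (a # \<mu>) = (\<Sum>i<Suc (length \<mu>). i * part (a # \<mu>) (Suc i))"
    unfolding n_stat_def One_nat_def sum.atLeast1_atMost_eq by (simp del: sum.lessThan_Suc)
  also have "\<dots> = (\<Sum>i<length \<mu>. i * part \<mu> (Suc i)) + (\<Sum>i<length \<mu>. part \<mu> (Suc i))"
    by (simp only: sum.lessThan_Suc_shift) (simp add: part_Cons_Suc sum.distrib add.commute)
  finally show ?thesis
    by (simp add: n_stat_def weight_def sum.atLeast1_atMost_eq)
qed

theorem theorem2:
  fixes n r k :: nat and lam \<nu> \<zeta> :: "nat list"
  assumes "is_partition lam" and "is_partition \<nu>" and "is_partition \<zeta>"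
    and "length \<nu> = k"
    and "part \<zeta> 1 < n"
    and "lam = map (\<lambda>p. n + p) \<nu> @ \<zeta>"
  shows "pleth (HL_Q' lam) (t_minus_alphabet r n) =
           tt ^ (n_stat \<nu> + r * weight \<nu>) *
           (\<Prod>i\<in>{r..<k + r}. \<Prod>j=1..n. (tt ^ i - indet j)) *
           pleth (HL_Q' \<zeta>) (t_minus_alphabet (k + r) n)"
  using assms(1,4,6)
proof (induction \<nu> arbitrary: lam k r)
  case Nil
  then show ?case
    by (simp add: n_stat_def weight_def)
next
  case (Cons a \<nu>)
  let ?\<mu> = "map (\<lambda>p. n + p) \<nu> @ \<zeta>"
  let ?p = "\<lambda>i. \<Prod>j=1..n. (tt ^ i - indet j) :: xpoly"
  have lam: "lam = (n + a) # ?\<mu>" and k: "k = Suc (length \<nu>)"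
    using Cons.prems by simp_all
  have \<mu>: "is_partition ?\<mu>"
    using Cons.prems(1) unfolding lam by (simp add: is_partition_def)
  have "{r..<k + r} = insert r {Suc r..<length \<nu> + Suc r}"
    unfolding k by auto
  then have prod: "(\<Prod>i\<in>{r..<k + r}. ?p i) = ?p r * (\<Prod>i\<in>{Suc r..<length \<nu> + Suc r}. ?p i)"
    by simp
  \<comment> \<open>The remaining parts are treated at \<open>r + 1\<close>; the extra
    \<open>weight \<nu>\<close> is what the new first row adds to \<open>n_stat\<close>.\<close>
  have exponent: "n_stat (a # \<nu>) + r * weight (a # \<nu>) = r * a + (n_stat \<nu> + Suc r * weight \<nu>)"
    by (simp add: n_stat_Cons weight_Cons algebra_simps)
  have "pleth (HL_Q' lam) (t_minus_alphabet r n) =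
      tt ^ (r * a) * ?p r * pleth (HL_Q' ?\<mu>) (t_minus_alphabet (Suc r) n)"
    unfolding lam using assms(5) by (intro pleth_HL_Q'_large_part[OF \<mu>]) simp
  also have "pleth (HL_Q' ?\<mu>) (t_minus_alphabet (Suc r) n) =
      tt ^ (n_stat \<nu> + Suc r * weight \<nu>) *
      (\<Prod>i\<in>{Suc r..<length \<nu> + Suc r}. ?p i) *
      pleth (HL_Q' \<zeta>) (t_minus_alphabet (length \<nu> + Suc r) n)"
    by (rule Cons.IH[OF \<mu> refl refl])
  finally show ?case
    unfolding prod exponent power_add[of tt "r * a"] by (simp add: k mult_ac)
qed

end
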